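(* Let $(m,n)$ be a coprime pair of positive integers, let $D\in\mathcal D_{m,n}$ have $(S,W)$-word $\Sigma$, and let $\widetilde R$ be the canonical rank sequence for $\Sigma$. Then every successive rank sequence $\widehat R^{(s)}$ produced by the StrongFindRank algorithm satisfies $\widehat R^{(s)}\preceq\widetilde R$; the successive rank sequences satisfy $\widehat R^{(0)}\prec\widehat R^{(1)}\prec\widehat R^{(2)}\prec\cdots$; and consequently there is a step $s$ with $\widehat R^{(s)}=\widetilde R$, at which the algorithm stops and outputs $\widetilde R$.
   Context: $(m,n)$-Dyck paths: lattice paths from $(0,0)$ to $(m,n)$ with $n$ North and $m$ East unit steps staying weakly above $y=nx/m$; $\mathcal D_{m,n}$ is their set. The $(S,W)$-word of a path writes $S$ for each North step and $W$ for each East step. Path diagram $T(\Sigma,R)$ for a word $\Sigma=\Sigma_1\cdots\Sigma_{m+n}$ with $n$ letters $S$ and $m$ letters $W$ and an integer sequence $R=(r_1,\dots,r_{m+n})$: arrows $A_1,\dots,A_{m+n}$, where $A_i$ goes from $(i-1,r_i)$ to $(i,r_i+m)$ (red) if $\Sigma_i=S$ and from $(i-1,r_i)$ to $(i,r_i-n)$ (blue) if $\Sigma_i=W$; $A_i$ starts at level $r_i$. Row $j$ ($j\in\mathbb Z$) is the strip between $y=j$ and $y=j+1$; a red arrow with starting rank $r$ has a segment in rows $r,\dots,r+m-1$, a blue one in rows $r-n,\dots,r-1$. The row count $c(j)$ is the number of red minus the number of blue arrows having a segment in row $j$. For sequences $R=(r_i)$, $R'=(r'_i)$ of length $m+n$,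 $R\preceq R'$ means $r_i\le r'_i$ for all $i$, and $R\prec R'$ means $R\preceq R'$ and $R\ne R'$. WeakFindRank algorithm from a weakly increasing nonnegative sequence: repeat: if all row counts of $T(\Sigma,R)$ are $\le 0$, stop and output $R$; otherwise let $j$ be the lowest row with $c(j)>0$, let $i$ be the largest index with $r_i=j$, and replace $r_i$ by $r_i+1$. Canonical starting sequence $R^{(0)}$ for $\Sigma$: replace each letter of the initial maximal run of $S$'s in $\Sigma$ by $0$ and every other letter by $m$. Canonical rank sequence $\widetilde R$: run WeakFindRank from $R^{(0)}$ (it terminates) obtaining $\overline R$, and set $\widetilde R=\overline R-(\overline r_1,\dots,\overline r_1)$. Strict cover: for a weakly increasing sequence $R=(r_1\le\cdots\le r_l)$, $\mathrm{sc}(R)=(r'_1<\cdots<r'_l)$ is defined by $r'_1=r_1$ and $r'_i=\max(r_i,r'_{i-1}+1)$ for $i\ge2$; it is the unique minimal strictly increasing sequence $R'$ with $R'\succeq R$. StrongFindRank algorithm: set $\widehat R^{(0)}=\mathrm{sc}(R^{(0)})$. At step $s$: if all row counts of $T(\Sigma,\widehat R^{(s)})$ are $\le 0$, stop and output $\widehat R^{(s)}$. Otherwise let $j$ be the lowest row with $c(j)>0$, let $i$ be the unique index with $\widehat r^{(s)}_i=j$, let $R'$ be obtained from $\widehat R^{(s)}$ by replacing $\widehat r^{(s)}_i$ with $\widehat r^{(s)}_i+1$, and set $\widehat R^{(s+1)}=\mathrm{sc}(R')$.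
   Formalization: In the canonical starting sequence, letters after the initial run of S's start at level n (any coprime m,n), or at level m only if m ≤ n; with level m the claim fails for every word with m > n, e.g. (m,n)=(2,1), SWW: sc(R^(0))=(0,2,3) is not below (0,1,2). *)

theory Defs
  imports Complex_Main "HOL-Library.While_Combinator"
begin

datatype path_step = North | East

text \<open>A lattice path starting at the origin is given by its list of steps;
  \<open>path_point D k\<close> is the lattice point \<open>(x, y)\<close> reached after \<open>k\<close> steps.\<close>

definition path_point :: "path_step list \<Rightarrow> nat \<Rightarrow> nat \<times> nat" where
  "path_point D k = (count_list (take k D) East, count_list (take k D) North)"

text \<open>It suffices to compare the lattice points of a path with the line \<open>y = n x / m\<close>:
  the unit steps between them are line segments.\<close>

definition dyck_paths :: "nat \<Rightarrow> nat \<Rightarrow> path_step list set" where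
  "dyck_paths m n = {D. path_point D (length D) = (m, n) \<and>
     (\<forall>k \<le> length D. case path_point D k of (x, y) \<Rightarrow> real y \<ge> real n * real x / real m)}"

datatype letter = S | W

definition sw_word :: "path_step list \<Rightarrow> letter list" where
  "sw_word D = map (\<lambda>d. case d of North \<Rightarrow> S | East \<Rightarrow> W) D"

text \<open>Words and rank sequences are lists, so indices start at \<open>0\<close>.
  In the path diagram of a word \<open>\<Sigma>\<close> and a sequence \<open>R\<close>, the arrow with index \<open>i\<close> starts at level
  \<open>R ! i\<close>; it climbs \<open>m\<close> levels (red) if its letter is \<open>S\<close> and descends \<open>n\<close> levels (blue) if its
  letter is \<open>W\<close>. Row \<open>j\<close> is the strip between the levels \<open>j\<close> and \<open>j + 1\<close>.\<close>

fun arrow_rows :: "nat \<Rightarrow> nat \<Rightarrow> letter \<Rightarrow> int \<Rightarrow> int set" where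
  "arrow_rows m n S r = {r..r + int m - 1}"
| "arrow_rows m n W r = {r - int n..r - 1}"

definition arrows_in_row ::
  "nat \<Rightarrow> nat \<Rightarrow> letter list \<Rightarrow> int list \<Rightarrow> letter \<Rightarrow> int \<Rightarrow> nat set" where
  "arrows_in_row m n \<Sigma> R a j = {i. i < length \<Sigma> \<and> \<Sigma> ! i = a \<and> j \<in> arrow_rows m n a (R ! i)}"

definition row_count :: "nat \<Rightarrow> nat \<Rightarrow> letter list \<Rightarrow> int list \<Rightarrow> int \<Rightarrow> int" where
  "row_count m n \<Sigma> R j =
     int (card (arrows_in_row m n \<Sigma> R S j)) - int (card (arrows_in_row m n \<Sigma> R W j))"

definition stop_condition :: "nat \<Rightarrow> nat \<Rightarrow> letter list \<Rightarrow> int list \<Rightarrow> bool" where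
  "stop_condition m n \<Sigma> R \<longleftrightarrow> (\<forall>j. row_count m n \<Sigma> R j \<le> 0)"

definition lowest_positive_row :: "nat \<Rightarrow> nat \<Rightarrow> letter list \<Rightarrow> int list \<Rightarrow> int" where
  "lowest_positive_row m n \<Sigma> R = (LEAST j. row_count m n \<Sigma> R j > 0)"

definition seq_le :: "int list \<Rightarrow> int list \<Rightarrow> bool" (infix "\<preceq>" 50) where
  "R \<preceq> R' \<longleftrightarrow> list_all2 (\<le>) R R'"

definition seq_less :: "int list \<Rightarrow> int list \<Rightarrow> bool" (infix "\<prec>" 50) where
  "R \<prec> R' \<longleftrightarrow> R \<preceq> R' \<and> R \<noteq> R'"

text \<open>The letters after the initial run of \<open>S\<close> start at level \<open>k\<close>. The starting sequence has to lie
  below the canonical rank sequence, in which the first \<open>W\<close>, and hence every later letter, has rank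
  at least \<open>n\<close> because blue arrows do not descend below level \<open>0\<close>. This holds for \<open>k = n\<close>, and for
  \<open>k = m\<close> if \<open>m \<le> n\<close>, but not for \<open>k = m\<close> if \<open>m > n\<close>: for \<open>(m, n) = (2, 1)\<close> and the word \<open>SWW\<close>, the
  level \<open>k = m\<close> yields the starting sequence \<open>(0, 2, 2)\<close>, its strict cover \<open>(0, 2, 3)\<close> and the
  canonical rank sequence \<open>(0, 1, 2)\<close>.\<close>

definition starting_seq :: "nat \<Rightarrow> letter list \<Rightarrow> int list" where
  "starting_seq k \<Sigma> =
     map (\<lambda>_. 0) (takeWhile (\<lambda>a. a = S) \<Sigma>) @ map (\<lambda>_. int k) (dropWhile (\<lambda>a. a = S) \<Sigma>)"

definition weak_step :: "nat \<Rightarrow> nat \<Rightarrow> letter list \<Rightarrow> int list \<Rightarrow> int list" where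
  "weak_step m n \<Sigma> R =
     (let i = (GREATEST i. i < length R \<and> R ! i = lowest_positive_row m n \<Sigma> R)
      in R[i := R ! i + 1])"

text \<open>If the loop did not terminate, \<^const>\<open>while\<close> would return an unspecified value, so
  nothing of substance can be proved about the output without establishing termination.\<close>

definition weak_find_rank :: "nat \<Rightarrow> nat \<Rightarrow> letter list \<Rightarrow> int list \<Rightarrow> int list" where
  "weak_find_rank m n \<Sigma> = while (\<lambda>R. \<not> stop_condition m n \<Sigma> R) (weak_step m n \<Sigma>)"

definition canonical_rank_seq :: "nat \<Rightarrow> nat \<Rightarrow> nat \<Rightarrow> letter list \<Rightarrow> int list" where
  "canonical_rank_seq k m n \<Sigma> =
     (let R = weak_find_rank m n \<Sigma> (starting_seq k \<Sigma>) in map (\<lambda>r. r - hd R) R)"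

text \<open>The second entry is raised to \<open>max r\<^sub>2 (r\<^sub>1 + 1)\<close> before the recursive call, so that
  each entry is compared with the already adjusted predecessor.\<close>

fun strict_cover :: "int list \<Rightarrow> int list" where
  "strict_cover [] = []"
| "strict_cover [r] = [r]"
| "strict_cover (r # r' # rs) = r # strict_cover (max r' (r + 1) # rs)"

definition strong_step :: "nat \<Rightarrow> nat \<Rightarrow> letter list \<Rightarrow> int list \<Rightarrow> int list" where
  "strong_step m n \<Sigma> R =
     (let i = (THE i. i < length R \<and> R ! i = lowest_positive_row m n \<Sigma> R)
      in strict_cover (R[i := R ! i + 1]))"

text \<open>\<open>strong_rank_seq k m n \<Sigma> s\<close> iterates the update rule regardless of the stopping condition.
  The sequences actually produced by the algorithm are those with \<open>strong_reaches k m n \<Sigma> s\<close>,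
  that is, those for which the algorithm has not stopped at an earlier step.\<close>

definition strong_rank_seq :: "nat \<Rightarrow> nat \<Rightarrow> nat \<Rightarrow> letter list \<Rightarrow> nat \<Rightarrow> int list" where
  "strong_rank_seq k m n \<Sigma> s = (strong_step m n \<Sigma> ^^ s) (strict_cover (starting_seq k \<Sigma>))"

definition strong_reaches :: "nat \<Rightarrow> nat \<Rightarrow> nat \<Rightarrow> letter list \<Rightarrow> nat \<Rightarrow> bool" where
  "strong_reaches k m n \<Sigma> s \<longleftrightarrow> (\<forall>t < s. \<not> stop_condition m n \<Sigma> (strong_rank_seq k m n \<Sigma> t))"

text \<open>The algorithm stops at step \<open>s\<close> and outputs \<open>R\<close>.\<close>

definition strong_outputs :: "nat \<Rightarrow> nat \<Rightarrow> nat \<Rightarrow> letter list \<Rightarrow> nat \<Rightarrow> int list \<Rightarrow> bool" where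
  "strong_outputs k m n \<Sigma> s R \<longleftrightarrow>
     strong_reaches k m n \<Sigma> s \<and> stop_condition m n \<Sigma> (strong_rank_seq k m n \<Sigma> s) \<and>
     R = strong_rank_seq k m n \<Sigma> s"

end

(* Since the row counts add up to 0, the stopping condition means that they all vanish, i.e. that as
   many arrows start as end at every level. For a diagram of this kind given by X, both algorithms
   preserve R \<preceq> X: if the arrow to be raised started at the same level j in R and in X, row j would
   have at most as many red and at least as many blue segments in R as in X, so its count in R would
   not be positive. Hence the output of WeakFindRank is the least stopping sequence above the starting
   one. It is strictly increasing, because the starting levels are distinct modulo m + n. Therefore
   StrongFindRank stays below the canonical rank sequence, stops as the sum of its ranks increases, and
   stops at the canonical rank sequence by minimality.

   WeakFindRank terminates: the Dyck condition and coprimality force a positive row below every large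
   gap between consecutive ranks, so all gaps stay bounded. A row is lowered only while its count is
   positive, so once all ranks exceed the initially negative rows, no row is negative. *)

theory Submission
  imports Defs
begin

section \<open>The componentwise order on rank sequences\<close>

lemma seq_le_iff: "R \<preceq> X \<longleftrightarrow> length R = length X \<and> (\<forall>i<length R. R ! i \<le> X ! i)"
  by (auto simp: seq_le_def list_all2_conv_all_nth)

lemma seq_le_refl: "R \<preceq> R"
  by (simp add: seq_le_iff)

lemma seq_le_trans: "R \<preceq> X \<Longrightarrow> X \<preceq> Y \<Longrightarrow> R \<preceq> Y"
  by (fastforce simp: seq_le_iff)

lemma seq_le_antisym: "R \<preceq> X \<Longrightarrow> X \<preceq> R \<Longrightarrow> R = X"
  by (auto simp: seq_le_iff intro!: nth_equalityI order.antisym)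

lemma seq_less_le_trans: "R \<prec> X \<Longrightarrow> X \<preceq> Y \<Longrightarrow> R \<prec> Y"
  by (metis seq_less_def seq_le_antisym seq_le_trans)

lemma sum_list_mono_seq_le: "R \<preceq> X \<Longrightarrow> sum_list R \<le> sum_list X"
  unfolding seq_le_def by (induction rule: list_all2_induct) auto

text \<open>Integer sums make strict increase measurable; both termination arguments use the sum of
  the ranks as their measure.\<close>

lemma sum_list_strict_mono_seq_less:
  assumes "R \<prec> X" shows "sum_list R < sum_list X"
proof -
  have "list_all2 (\<le>) R X \<Longrightarrow> R \<noteq> X \<Longrightarrow> sum_list R < sum_list X"
  proof (induction rule: list_all2_induct)
    case (Cons x xs y ys)
    have "sum_list xs \<le> sum_list ys"
      using Cons by (intro sum_list_mono_seq_le) (simp add: seq_le_def)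
    then show ?case using Cons by (cases "xs = ys") auto
  qed simp
  then show ?thesis using assms by (simp add: seq_less_def seq_le_def)
qed

lemma seq_less_increment: "i < length R \<Longrightarrow> R \<prec> R[i := R ! i + 1]"
  unfolding seq_less_def seq_le_iff
  by (auto simp: nth_list_update) (metis less_add_one less_irrefl nth_list_update_eq)

section \<open>Strict covers\<close>

lemma length_strict_cover [simp]: "length (strict_cover R) = length R"
  by (induction R rule: strict_cover.induct) auto

lemma hd_strict_cover: "hd (strict_cover R) = hd R"
  by (induction R rule: strict_cover.induct) auto

lemma seq_le_strict_cover: "R \<preceq> strict_cover R"
proof (induction R rule: strict_cover.induct)
  case (3 r r' rs)
  from 3 show ?case
    by (cases "strict_cover (max r' (r + 1) # rs)") (auto simp: seq_le_def)
qed (auto simp: seq_le_def)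

lemma strict_sorted_strict_cover: "sorted_wrt (<) (strict_cover R)"
proof (induction R rule: strict_cover.induct)
  case (3 r r' rs)
  have "hd (strict_cover (max r' (r + 1) # rs)) = max r' (r + 1)"
    by (simp add: hd_strict_cover)
  moreover obtain x xs where "strict_cover (max r' (r + 1) # rs) = x # xs"
    by (metis length_strict_cover list.exhaust list.size(3) list.distinct(1) length_0_conv)
  ultimately show ?case using 3 by (fastforce)
qed auto

lemma strict_cover_le: "R \<preceq> X \<Longrightarrow> sorted_wrt (<) X \<Longrightarrow> strict_cover R \<preceq> X"
proof (induction R arbitrary: X rule: strict_cover.induct)
  case (3 r r' rs)
  then obtain x x' xs where X: "X = x # x' # xs"
    by (auto simp: seq_le_def list_all2_Cons1)
  \<comment> \<open>Over the integers, \<open>r \<le> x < x'\<close> gives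
    \<open>r + 1 \<le> x'\<close>, so the adjusted second entry still lies below
    \<open>x'\<close>.\<close>
  then have "strict_cover (max r' (r + 1) # rs) \<preceq> x' # xs"
    using 3 by (intro "3.IH") (auto simp: seq_le_def)
  then show ?case using 3 X by (auto simp: seq_le_def)
qed auto

section \<open>Row counts as sums of signed contributions of arrows\<close>

text \<open>In contrast to the two cardinalities in \<open>row_count\<close>, signed contributions
  can be compared arrow by arrow.\<close>

definition arrow_count :: "nat \<Rightarrow> nat \<Rightarrow> letter \<Rightarrow> int \<Rightarrow> int \<Rightarrow> int" where
  "arrow_count m n a r j =
     (case a of S \<Rightarrow> of_bool (r \<le> j \<and> j < r + int m) | W \<Rightarrow> - of_bool (r - int n \<le> j \<and> j < r))"

definition arrow_end :: "nat \<Rightarrow> nat \<Rightarrow> letter \<Rightarrow> int \<Rightarrow> int" where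
  "arrow_end m n a r = (case a of S \<Rightarrow> r + int m | W \<Rightarrow> r - int n)"

lemma row_count_eq_sum:
  "row_count m n \<Sigma> R j = (\<Sum>i<length \<Sigma>. arrow_count m n (\<Sigma> ! i) (R ! i) j)"
proof -
  have *: "int (card (arrows_in_row m n \<Sigma> R a j)) =
      (\<Sum>i<length \<Sigma>. of_bool (\<Sigma> ! i = a \<and> j \<in> arrow_rows m n a (R ! i)))" for a
  proof -
    have "arrows_in_row m n \<Sigma> R a j =
        {..<length \<Sigma>} \<inter> {i. \<Sigma> ! i = a \<and> j \<in> arrow_rows m n a (R ! i)}"
      by (auto simp: arrows_in_row_def)
    then show ?thesis by (simp add: sum_of_bool_eq)
  qed
  show ?thesis unfolding row_count_def * sum_subtractf [symmetric]
    by (intro sum.cong) (auto simp: arrow_count_def split: letter.splits)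
qed

text \<open>When level \<open>j\<close> is crossed upwards, a contribution can grow only at the
  start of its arrow: a red arrow enters there, a blue one leaves.\<close>

lemma arrow_count_no_start:
  "r \<noteq> j \<Longrightarrow> arrow_count m n a r j \<le> arrow_count m n a r (j - 1)"
  by (auto simp: arrow_count_def split: letter.splits)

lemma arrow_count_no_start_end:
  "m > 0 \<Longrightarrow> n > 0 \<Longrightarrow> arrow_end m n a r = j \<Longrightarrow> arrow_count m n a r j < arrow_count m n a r (j - 1)"
  by (auto simp: arrow_count_def arrow_end_def split: letter.splits)

text \<open>Raising a start from \<open>r\<close> to \<open>r + 1\<close> can cost only row
  \<open>r\<close>: a red arrow leaves this row and a blue one enters it. At their other ends a red
  arrow gains a row and a blue one gives one up.\<close>

lemma arrow_count_raise:
  "arrow_count m n a r j \<le> arrow_count m n a (r + 1) j + of_bool (r = j)"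
  by (auto simp: arrow_count_def split: letter.splits)

lemma row_count_no_start:
  "(\<And>i. i < length \<Sigma> \<Longrightarrow> R ! i \<noteq> j) \<Longrightarrow> row_count m n \<Sigma> R j \<le> row_count m n \<Sigma> R (j - 1)"
  unfolding row_count_eq_sum by (intro sum_mono arrow_count_no_start) auto

lemma row_count_no_start_end:
  assumes "m > 0" "n > 0" "\<And>i. i < length \<Sigma> \<Longrightarrow> R ! i \<noteq> j"
    and "a < length \<Sigma>" "arrow_end m n (\<Sigma> ! a) (R ! a) = j"
  shows "row_count m n \<Sigma> R j < row_count m n \<Sigma> R (j - 1)"
  unfolding row_count_eq_sum using assms
  by (intro sum_strict_mono_ex1 ballI bexI [of _ a] arrow_count_no_start arrow_count_no_start_end) auto

lemma row_count_raise:
  assumes "i < length R"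
  shows "row_count m n \<Sigma> R j \<le>
    row_count m n \<Sigma> (R[i := R ! i + 1]) j + of_bool (R ! i = j)"
proof -
  have "row_count m n \<Sigma> R j \<le> (\<Sum>a<length \<Sigma>.
      arrow_count m n (\<Sigma> ! a) (R[i := R ! i + 1] ! a) j + of_bool (a = i \<and> R ! i = j))"
    unfolding row_count_eq_sum
  proof (intro sum_mono)
    fix a
    show "arrow_count m n (\<Sigma> ! a) (R ! a) j \<le>
      arrow_count m n (\<Sigma> ! a) (R[i := R ! i + 1] ! a) j + of_bool (a = i \<and> R ! i = j)"
      using arrow_count_raise [of m n "\<Sigma> ! a" "R ! a" j] assms
      by (cases "a = i") auto
  qed
  also have "\<dots> = row_count m n \<Sigma> (R[i := R ! i + 1]) j + (\<Sum>a<length \<Sigma>. of_bool (a = i \<and> R ! i = j))"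
    by (simp add: row_count_eq_sum sum.distrib)
  also have "(\<Sum>a<length \<Sigma>. of_bool (a = i \<and> R ! i = j)) \<le> (of_bool (R ! i = j) :: int)"
    by (cases "R ! i = j") (auto simp: of_bool_def sum.delta')
  finally show ?thesis by simp
qed

lemma row_count_eq_0_below:
  assumes "\<And>i. i < length \<Sigma> \<Longrightarrow> j < R ! i - int n"
  shows "row_count m n \<Sigma> R j = 0"
  unfolding row_count_eq_sum
proof (intro sum.neutral ballI)
  fix i assume "i \<in> {..<length \<Sigma>}"
  with assms [of i] show "arrow_count m n (\<Sigma> ! i) (R ! i) j = 0"
    by (auto simp: arrow_count_def split: letter.splits)
qed

lemma row_count_eq_0_above:
  assumes "\<And>i. i < length \<Sigma> \<Longrightarrow> R ! i + int m \<le> j"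
  shows "row_count m n \<Sigma> R j = 0"
  unfolding row_count_eq_sum
proof (intro sum.neutral ballI)
  fix i assume "i \<in> {..<length \<Sigma>}"
  with assms [of i] show "arrow_count m n (\<Sigma> ! i) (R ! i) j = 0"
    by (auto simp: arrow_count_def split: letter.splits)
qed

lemma sum_indicator_interval:
  fixes a b lo hi :: int
  assumes "lo \<le> a" "b \<le> hi + 1" "a \<le> b"
  shows "(\<Sum>j\<in>{lo..hi}. of_bool (a \<le> j \<and> j < b) :: int) = b - a"
proof -
  have "{lo..hi} \<inter> {j. a \<le> j \<and> j < b} = {a..<b}" using assms by auto
  then show ?thesis using assms by (simp add: sum_of_bool_eq)
qed

text \<open>The window \<open>{lo..hi}\<close> contains all rows of the first \<open>p\<close>
  arrows and lies below all rows of the others. Hence each red arrow of the prefix contributes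
  \<open>m\<close>, each blue one \<open>- n\<close>, and every later arrow 0.\<close>

lemma sum_row_count_prefix:
  assumes p: "p \<le> length \<Sigma>"
    and lo: "\<And>i. i < p \<Longrightarrow> lo \<le> R ! i - int n \<and> R ! i + int m \<le> hi"
    and hi: "\<And>i. p \<le> i \<Longrightarrow> i < length \<Sigma> \<Longrightarrow> hi < R ! i - int n"
  shows "(\<Sum>j\<in>{lo..hi}. row_count m n \<Sigma> R j) =
    int m * int (count_list (take p \<Sigma>) S) - int n * int (count_list (take p \<Sigma>) W)"
proof -
  let ?d = "\<lambda>i. case \<Sigma> ! i of S \<Rightarrow> int m | W \<Rightarrow> - int n"
  have low: "(\<Sum>j\<in>{lo..hi}. arrow_count m n (\<Sigma> ! i) (R ! i) j) = ?d i" if "i < p" for i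
    using lo [OF that]
      sum_indicator_interval [of lo "R ! i" "R ! i + int m" hi]
      sum_indicator_interval [of lo "R ! i - int n" "R ! i" hi]
    by (auto simp: arrow_count_def sum_negf split: letter.splits)
  have high: "(\<Sum>j\<in>{lo..hi}. arrow_count m n (\<Sigma> ! i) (R ! i) j) = 0"
    if "p \<le> i" "i < length \<Sigma>" for i
    using hi [OF that] by (intro sum.neutral) (auto simp: arrow_count_def split: letter.splits)
  have "(\<Sum>j\<in>{lo..hi}. row_count m n \<Sigma> R j) =
      (\<Sum>i<length \<Sigma>. \<Sum>j\<in>{lo..hi}. arrow_count m n (\<Sigma> ! i) (R ! i) j)"
    unfolding row_count_eq_sum by (rule sum.swap)
  also have "\<dots> = (\<Sum>i<p. ?d i)"
    using p by (intro sum.mono_neutral_cong_right) (auto simp: low high)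
  also have "\<dots> =
      int m * int (count_list (take p \<Sigma>) S) - int n * int (count_list (take p \<Sigma>) W)"
    using p
  proof (induction p)
    case (Suc p)
    then show ?case
      by (cases "\<Sigma> ! p") (auto simp: take_Suc_conv_app_nth algebra_simps)
  qed simp
  finally show ?thesis .
qed

text \<open>Arrows up to \<open>i\<close> start at level \<open>j\<close> or lower in both
  sequences: the blue ones miss row \<open>j\<close>, and a higher start only helps a red one to
  reach it. Later arrows start above \<open>j\<close> in both: the red ones miss row
  \<open>j\<close>, and a higher start can only take a blue one out of it.\<close>

lemma row_count_le_of_seq_le:
  assumes "R \<preceq> X" "length R = length \<Sigma>" "sorted R" "sorted X"
    and i: "i < length \<Sigma>" "R ! i = j" "X ! i = j"
    and after: "\<And>a. i < a \<Longrightarrow> a < length \<Sigma> \<Longrightarrow> j < R ! a"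
  shows "row_count m n \<Sigma> R j \<le> row_count m n \<Sigma> X j"
  unfolding row_count_eq_sum
proof (intro sum_mono)
  fix a assume "a \<in> {..<length \<Sigma>}"
  then have a: "a < length \<Sigma>" by simp
  have le: "R ! a \<le> X ! a" and len: "length X = length \<Sigma>"
    using assms a by (auto simp: seq_le_iff)
  show "arrow_count m n (\<Sigma> ! a) (R ! a) j \<le> arrow_count m n (\<Sigma> ! a) (X ! a) j"
  proof (cases "a \<le> i")
    case True
    then have "X ! a \<le> j" using sorted_nth_mono [OF \<open>sorted X\<close> True] i len by simp
    then show ?thesis using le by (auto simp: arrow_count_def split: letter.splits)
  next
    case False
    then have "j < R ! a" using after a by simp
    then show ?thesis using le by (auto simp: arrow_count_def split: letter.splits)
  qed
qed

section \<open>Single steps of the two algorithms\<close>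

text \<open>A least element of a set of integers need not exist; here the positive rows lie in a
  bounded window, so it does. An arrow starts at this level, since otherwise row
  \<open>j - 1\<close> would have at least the same count.\<close>

lemma lowest_positive_row:
  assumes "\<not> stop_condition m n \<Sigma> R"
  defines "j \<equiv> lowest_positive_row m n \<Sigma> R"
  shows "row_count m n \<Sigma> R j > 0" and "\<And>j'. row_count m n \<Sigma> R j' > 0 \<Longrightarrow> j \<le> j'"
    and "\<exists>i<length \<Sigma>. R ! i = j"
proof -
  define P where "P = {j. row_count m n \<Sigma> R j > 0}"
  define lo where "lo = Min ((!) R ` {..<length \<Sigma>}) - int n"
  define hi where "hi = Max ((!) R ` {..<length \<Sigma>}) + int m"
  have "lo \<le> R ! i - int n" "R ! i + int m \<le> hi" if "i < length \<Sigma>" for i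
    using that by (auto simp: lo_def hi_def)
  then have "P \<subseteq> {lo..hi}"
    using row_count_eq_0_below [of \<Sigma> _ R n m] row_count_eq_0_above [of \<Sigma> R m _ n]
    unfolding P_def by (smt (verit) atLeastAtMost_iff mem_Collect_eq subsetI)
  then have fin: "finite P" by (rule finite_subset) simp
  have ne: "P \<noteq> {}" using assms(1) by (auto simp: P_def stop_condition_def not_le)
  have "j = Min P"
    unfolding j_def lowest_positive_row_def
    using Min_in [OF fin ne] Min_le [OF fin] by (intro Least_equality) (auto simp: P_def)
  then show pos: "row_count m n \<Sigma> R j > 0" and least: "\<And>j'. row_count m n \<Sigma> R j' > 0 \<Longrightarrow> j \<le> j'"
    using Min_in [OF fin ne] Min_le [OF fin] by (auto simp: P_def)
  show "\<exists>i<length \<Sigma>. R ! i = j"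
  proof (rule ccontr)
    assume "\<not> ?thesis"
    then have "row_count m n \<Sigma> R j \<le> row_count m n \<Sigma> R (j - 1)"
      by (intro row_count_no_start) auto
    then show False using pos least [of "j - 1"] by simp
  qed
qed

lemma weak_step_eq:
  assumes "\<not> stop_condition m n \<Sigma> R" "length R = length \<Sigma>" "sorted R"
  obtains i where "i < length \<Sigma>" "R ! i = lowest_positive_row m n \<Sigma> R"
    "\<And>a. i < a \<Longrightarrow> a < length \<Sigma> \<Longrightarrow> R ! i < R ! a"
    "weak_step m n \<Sigma> R = R[i := R ! i + 1]"
proof
  let ?Q = "\<lambda>i. i < length R \<and> R ! i = lowest_positive_row m n \<Sigma> R"
  let ?i = "GREATEST i. ?Q i"
  obtain i where "?Q i" using lowest_positive_row(3) [OF assms(1)] assms(2) by auto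
  then have Q: "?Q ?i" and greatest: "\<And>a. ?Q a \<Longrightarrow> a \<le> ?i"
    using GreatestI_nat [of ?Q i "length R"] Greatest_le_nat [of ?Q _ "length R"] by auto
  show "?i < length \<Sigma>" "R ! ?i = lowest_positive_row m n \<Sigma> R"
    using Q assms(2) by auto
  show "R ! ?i < R ! a" if "?i < a" "a < length \<Sigma>" for a
    using that Q greatest [of a] assms(2) sorted_nth_mono [OF assms(3), of ?i a] by fastforce
  show "weak_step m n \<Sigma> R = R[?i := R ! ?i + 1]"
    by (simp add: weak_step_def Let_def)
qed

lemma strong_step_eq:
  assumes "\<not> stop_condition m n \<Sigma> R" "length R = length \<Sigma>" "sorted_wrt (<) R"
  obtains i where "i < length \<Sigma>" "R ! i = lowest_positive_row m n \<Sigma> R"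
    "\<And>a. i < a \<Longrightarrow> a < length \<Sigma> \<Longrightarrow> R ! i < R ! a"
    "strong_step m n \<Sigma> R = strict_cover (R[i := R ! i + 1])"
proof -
  obtain i where i: "i < length \<Sigma>" "R ! i = lowest_positive_row m n \<Sigma> R"
    using lowest_positive_row(3) [OF assms(1)] by auto
  have "(THE i. i < length R \<and> R ! i = lowest_positive_row m n \<Sigma> R) = i"
  proof (rule the_equality)
    fix a assume "a < length R \<and> R ! a = lowest_positive_row m n \<Sigma> R"
    then show "a = i"
      using i assms(2,3) by (metis nth_eq_iff_index_eq strict_sorted_iff)
  qed (use i assms(2) in auto)
  then have "strong_step m n \<Sigma> R = strict_cover (R[i := R ! i + 1])"
    by (simp add: strong_step_def)
  with i show thesis using assms(2,3) by (intro that) (auto simp: sorted_wrt_iff_nth_less)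
qed

text \<open>The argument shared by both algorithms: if \<open>R ! i = X ! i\<close>, the comparison
  of row counts at this level would give \<open>X\<close> a positive row.\<close>

lemma seq_le_increment:
  assumes "R \<preceq> X" "length R = length \<Sigma>" "sorted R" "sorted X" "stop_condition m n \<Sigma> X"
    and "row_count m n \<Sigma> R (R ! i) > 0" "i < length \<Sigma>"
    and "\<And>a. i < a \<Longrightarrow> a < length \<Sigma> \<Longrightarrow> R ! i < R ! a"
  shows "R[i := R ! i + 1] \<preceq> X"
proof -
  have "R ! i \<noteq> X ! i"
  proof
    assume "R ! i = X ! i"
    then have "row_count m n \<Sigma> R (R ! i) \<le> row_count m n \<Sigma> X (R ! i)"
      using assms by (intro row_count_le_of_seq_le) auto
    also have "\<dots> \<le> 0" using assms(5) by (simp add: stop_condition_def)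
    finally show False using assms(6) by simp
  qed
  moreover have "R ! i \<le> X ! i" using assms by (auto simp: seq_le_iff)
  ultimately show ?thesis using assms(1,2,7) by (auto simp: seq_le_iff nth_list_update)
qed

text \<open>Translation of the diagram; it carries the stopping condition over to the normalised
  sequence.\<close>

lemma row_count_shift:
  assumes "length R = length \<Sigma>"
  shows "row_count m n \<Sigma> (map (\<lambda>r. r - d) R) j = row_count m n \<Sigma> R (j + d)"
  unfolding row_count_eq_sum using assms
  by (intro sum.cong) (auto simp: arrow_count_def split: letter.splits)

section \<open>Words of Dyck paths and their stopping sequences\<close>

lemma length_eq_count_list: "length xs = count_list xs S + count_list xs W"
proof (induction xs)
  case (Cons x xs) then show ?case by (cases x) auto
qed simp

text \<open>The path enters only through its word. The last assumption is the Dyck condition cleared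
  of denominators, for every prefix length \<open>p\<close>.\<close>

locale dyck_word =
  fixes m n :: nat and \<Sigma> :: "letter list"
  assumes m_pos: "m > 0" and n_pos: "n > 0" and coprime: "coprime m n"
    and count_S: "count_list \<Sigma> S = n" and count_W: "count_list \<Sigma> W = m"
    and prefix: "n * count_list (take p \<Sigma>) W \<le> m * count_list (take p \<Sigma>) S"
begin

lemma length_eq: "length \<Sigma> = m + n"
  using length_eq_count_list [of \<Sigma>] count_S count_W by simp

text \<open>Equality would put the end of a proper nonempty prefix on the diagonal. By coprimality
  \<open>m\<close> divides its number of \<open>W\<close>s, which is therefore 0 or
  \<open>m\<close>, and only the two endpoints of the path remain.\<close>

lemma prefix_strict:
  assumes "0 < p" "p < length \<Sigma>"
  shows "n * count_list (take p \<Sigma>) W < m * count_list (take p \<Sigma>) S"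
proof -
  let ?s = "count_list (take p \<Sigma>) S" and ?w = "count_list (take p \<Sigma>) W"
  have sw: "?s + ?w = p"
    using length_eq_count_list [of "take p \<Sigma>"] assms by simp
  have "?s \<le> n" "?w \<le> m"
    using count_S count_W count_list_append [of "take p \<Sigma>" "drop p \<Sigma>"] by auto
  have "n * ?w \<noteq> m * ?s"
  proof
    assume eq: "n * ?w = m * ?s"
    then have "m dvd n * ?w" by simp
    then have "m dvd ?w" using coprime by (simp add: coprime_dvd_mult_right_iff)
    then have "?w = 0 \<or> ?w = m" using \<open>?w \<le> m\<close> by (auto dest: dvd_imp_le)
    then show False
    proof
      assume "?w = 0"
      with eq m_pos have "?s = 0" by simp
      with \<open>?w = 0\<close> sw assms show False by simp
    next
      assume "?w = m"
      with eq m_pos have "?s = n" by simp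
      with \<open>?w = m\<close> sw assms length_eq show False by simp
    qed
  qed
  with prefix [of p] show ?thesis by simp
qed

text \<open>Over a window containing all arrows the counts add up to
  \<open>m * n - n * m = 0\<close>, so counts of one sign vanish. The window is widened to include
  \<open>j\<close>.\<close>

lemma row_counts_zero:
  assumes "length R = length \<Sigma>"
    and "(\<forall>j. row_count m n \<Sigma> R j \<le> 0) \<or> (\<forall>j. row_count m n \<Sigma> R j \<ge> 0)"
  shows "row_count m n \<Sigma> R j = 0"
proof -
  define lo where "lo = min j (Min (set R) - int n)"
  define hi where "hi = max j (Max (set R) + int m)"
  have *: "lo \<le> R ! i - int n \<and> R ! i + int m \<le> hi" if "i < length \<Sigma>" for i
    using that assms(1) by (auto simp: lo_def hi_def min_le_iff_disj le_max_iff_disj)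
  have sum0: "(\<Sum>j\<in>{lo..hi}. row_count m n \<Sigma> R j) = 0"
    using sum_row_count_prefix [of "length \<Sigma>" \<Sigma> lo R n m hi] * count_S count_W by simp
  have j: "j \<in> {lo..hi}" by (auto simp: lo_def hi_def)
  from assms(2) show ?thesis
  proof
    assume "\<forall>j. row_count m n \<Sigma> R j \<ge> 0"
    then show ?thesis
      using sum0 j by (subst (asm) sum_nonneg_eq_0_iff) auto
  next
    assume "\<forall>j. row_count m n \<Sigma> R j \<le> 0"
    then show ?thesis
      using sum0 j sum_nonneg_eq_0_iff [of "{lo..hi}" "\<lambda>j. - row_count m n \<Sigma> R j"]
      by (simp add: sum_negf)
  qed
qed

lemma stop_condition_iff:
  "length R = length \<Sigma> \<Longrightarrow> stop_condition m n \<Sigma> R \<longleftrightarrow> (\<forall>j. row_count m n \<Sigma> R j = 0)"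
  unfolding stop_condition_def by (metis order.refl row_counts_zero)

text \<open>At a level where an arrow ends and none starts, the row count would drop strictly, which
  is impossible if all counts are 0.\<close>

lemma arrow_end_in_set:
  assumes "length R = length \<Sigma>" "stop_condition m n \<Sigma> R" "i < length \<Sigma>"
  shows "arrow_end m n (\<Sigma> ! i) (R ! i) \<in> set R"
proof (rule ccontr)
  let ?j = "arrow_end m n (\<Sigma> ! i) (R ! i)"
  assume "?j \<notin> set R"
  then have "row_count m n \<Sigma> R ?j < row_count m n \<Sigma> R (?j - 1)"
    using assms m_pos n_pos by (intro row_count_no_start_end [of _ _ _ _ _ i]) (metis nth_mem)+
  then show False using assms stop_condition_iff by simp
qed

text \<open>Modulo \<open>m + n\<close> every arrow ascends by \<open>m\<close>, so the residues of the starting levels are closed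
  under adding the unit \<open>m\<close>: each of the \<open>m + n\<close> residues occurs.\<close>

lemma distinct_of_stop:
  assumes "length R = length \<Sigma>" "stop_condition m n \<Sigma> R"
  shows "distinct R"
proof -
  define N where "N = int (m + n)"
  define A where "A = (\<lambda>r. r mod N) ` set R"
  have N: "N > 0" using m_pos by (simp add: N_def)
  have shift: "(x + int m) mod N \<in> A" if x: "x mod N \<in> A" for x
  proof -
    obtain i where i: "i < length \<Sigma>" "x mod N = R ! i mod N"
      using x assms(1) by (auto simp: A_def in_set_conv_nth)
    have "arrow_end m n (\<Sigma> ! i) (R ! i) mod N = (R ! i + int m) mod N"
    proof (cases "\<Sigma> ! i")
      case W
      have "(R ! i + int m) mod N = (R ! i - int n + N) mod N" by (simp add: N_def)
      then show ?thesis using W by (simp add: arrow_end_def)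
    qed (simp add: arrow_end_def)
    also have "\<dots> = (x + int m) mod N" using i by (metis mod_add_left_eq)
    finally show ?thesis using arrow_end_in_set [OF assms i(1)] unfolding A_def by (metis imageI)
  qed
  obtain x where x: "x mod N \<in> A"
    using assms(1) length_eq m_pos
    by (metis A_def add_gr_0 imageI length_greater_0_conv nth_mem)
  have iter: "(x + int t * int m) mod N \<in> A" for t
  proof (induction t)
    case (Suc t)
    then show ?case using shift [of "x + int t * int m"] by (simp add: algebra_simps)
  qed (simp add: x)
  have inj: "inj_on (\<lambda>t. (x + int t * int m) mod N) {..<m + n}"
  proof (rule inj_onI)
    fix s t assume st: "s \<in> {..<m + n}" "t \<in> {..<m + n}"
      and "(x + int s * int m) mod N = (x + int t * int m) mod N"
    then have "N dvd (x + int s * int m) - (x + int t * int m)" by (simp add: mod_eq_dvd_iff)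
    then have "N dvd (int s - int t) * int m" by (simp add: algebra_simps)
    moreover have "Rings.coprime N (int m)"
      using coprime unfolding N_def coprime_int_iff
      by (simp add: coprime_iff_gcd_eq_1 gcd.commute)
    ultimately have "N dvd int s - int t" by (simp add: coprime_dvd_mult_left_iff)
    then have "int s mod N = int t mod N" by (simp add: mod_eq_dvd_iff)
    then show "s = t" using st by (simp add: N_def)
  qed
  \<comment> \<open>All \<open>m + n\<close> residues occur among the \<open>m + n\<close> entries
    of \<open>R\<close>, so no entry is repeated.\<close>
  have "m + n \<le> card A"
    using card_inj_on_le [OF inj, of A] iter by (auto simp: A_def)
  also have "card A \<le> card (set R)" unfolding A_def by (rule card_image_le) simp
  finally have "card (set R) = length R"
    using card_length [of R] assms(1) length_eq by simp
  then show ?thesis by (rule card_distinct)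
qed

section \<open>Termination and minimality of WeakFindRank\<close>

text \<open>The gap separates the rows of the first \<open>Suc p\<close> arrows from all later ones.
  The counts up to level \<open>hi\<close> therefore add up to a quantity of this prefix alone,
  which is positive by the strict Dyck condition.\<close>

lemma positive_row_below_gap:
  assumes "length R = length \<Sigma>" "sorted R" "Suc p < length \<Sigma>"
    and gap: "R ! p + int m + int n < R ! Suc p"
  shows "\<exists>j. j < R ! Suc p \<and> row_count m n \<Sigma> R j > 0"
proof -
  define lo where "lo = R ! 0 - int n"
  define hi where "hi = R ! p + int m"
  have "lo \<le> R ! i - int n \<and> R ! i + int m \<le> hi" if "i < Suc p" for i
    using that assms sorted_nth_mono [OF assms(2), of 0 i] sorted_nth_mono [OF assms(2), of i p]
    by (auto simp: lo_def hi_def)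
  moreover have "hi < R ! i - int n" if "Suc p \<le> i" "i < length \<Sigma>" for i
    using that assms sorted_nth_mono [OF assms(2), of "Suc p" i] by (auto simp: hi_def)
  ultimately have "(\<Sum>j\<in>{lo..hi}. row_count m n \<Sigma> R j) =
      int m * int (count_list (take (Suc p) \<Sigma>) S) - int n * int (count_list (take (Suc p) \<Sigma>) W)"
    using assms by (intro sum_row_count_prefix) auto
  also have "\<dots> > 0"
    using prefix_strict [of "Suc p"] assms(3) by (metis diff_gt_0_iff_gt of_nat_less_iff of_nat_mult zero_less_Suc)
  finally obtain j where "j \<in> {lo..hi}" "row_count m n \<Sigma> R j > 0"
    by (metis not_less sum_nonpos)
  then show ?thesis using gap by (intro exI [of _ j]) (simp add: hi_def)
qed

text \<open>The gap bound and the rows above the fixed level \<open>M\<close> serve termination; the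
  last clause records that the run stays below every sorted stopping sequence above
  \<open>R0\<close>.\<close>

definition weak_invariant :: "int list \<Rightarrow> int list \<Rightarrow> int \<Rightarrow> bool" where
  "weak_invariant R0 R M \<longleftrightarrow> length R = length \<Sigma> \<and> sorted R \<and> R0 \<preceq> R \<and>
     (\<forall>i. Suc i < length \<Sigma> \<longrightarrow> R ! Suc i \<le> R ! i + int (m + n + 1)) \<and>
     (\<forall>j>M. row_count m n \<Sigma> R j \<ge> 0) \<and>
     (\<forall>X. sorted X \<longrightarrow> stop_condition m n \<Sigma> X \<longrightarrow> R0 \<preceq> X \<longrightarrow> R \<preceq> X)"

lemma weak_invariant_step:
  assumes inv: "weak_invariant R0 R M" and "\<not> stop_condition m n \<Sigma> R"
  shows "weak_invariant R0 (weak_step m n \<Sigma> R) M" "R \<prec> weak_step m n \<Sigma> R"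
proof -
  note inv = inv [unfolded weak_invariant_def]
  note low = lowest_positive_row [OF assms(2)]
  have len: "length R = length \<Sigma>" and "sorted R" using inv by auto
  then obtain i where i: "i < length \<Sigma>" "R ! i = lowest_positive_row m n \<Sigma> R"
      "\<And>a. i < a \<Longrightarrow> a < length \<Sigma> \<Longrightarrow> R ! i < R ! a"
    and step: "weak_step m n \<Sigma> R = R[i := R ! i + 1]"
    by (rule weak_step_eq [OF assms(2)]) blast
  have less: "R \<prec> R[i := R ! i + 1]" using i len by (intro seq_less_increment) simp
  then show "R \<prec> weak_step m n \<Sigma> R" by (simp add: step)
  have sorted: "sorted (R[i := R ! i + 1])"
    unfolding sorted_iff_nth_mono_less
  proof (intro allI impI)
    fix a b assume ab: "a < b" "b < length (R[i := R ! i + 1])"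
    then show "R[i := R ! i + 1] ! a \<le> R[i := R ! i + 1] ! b"
      using len i(1) i(3) [of b] sorted_nth_mono [OF \<open>sorted R\<close>, of a b]
      by (auto simp: nth_list_update)
  qed
  have gaps: "R[i := R ! i + 1] ! Suc p \<le> R[i := R ! i + 1] ! p + int (m + n + 1)"
    if p: "Suc p < length \<Sigma>" for p
  proof (cases "i = Suc p")
    case True
    \<comment> \<open>The raised rank is the lowest positive row, so a wider gap, having a positive
      row below it, is excluded. Raising adds 1, whence the bound \<open>m + n + 1\<close> in the
      invariant.\<close>
    have "R ! Suc p \<le> R ! p + int m + int n"
    proof (rule ccontr)
      assume "\<not> ?thesis"
      then obtain j where "j < R ! Suc p" "row_count m n \<Sigma> R j > 0"
        using positive_row_below_gap [of R p] p inv by auto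
      then show False using low(2) [of j] i(2) True by simp
    qed
    then show ?thesis using True p len by (simp add: nth_list_update)
  next
    case False
    have "R ! Suc p \<le> R ! p + int (m + n + 1)" using inv p by blast
    then show ?thesis using False p len i(1) by (simp add: nth_list_update)
  qed
  have rows: "row_count m n \<Sigma> (R[i := R ! i + 1]) j \<ge> 0" if "j > M" for j
  proof (cases "R ! i = j")
    \<comment> \<open>The row of the raised start loses at most 1, and its count was
      positive.\<close>
    case True
    then show ?thesis using low(1) i(2) row_count_raise [of i R m n \<Sigma> j] i(1) len by simp
  next
    case False
    have "row_count m n \<Sigma> R j \<ge> 0" using inv that by blast
    then show ?thesis using False row_count_raise [of i R m n \<Sigma> j] i(1) len by simp
  qed
  have minimal: "R[i := R ! i + 1] \<preceq> X"
    if X: "sorted X" "stop_condition m n \<Sigma> X" "R0 \<preceq> X" for X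
  proof (rule seq_le_increment [OF _ len \<open>sorted R\<close> X(1,2) _ i(1,3)])
    show "R \<preceq> X" using inv X by blast
    show "row_count m n \<Sigma> R (R ! i) > 0" using low(1) i(2) by simp
  qed
  have "R0 \<preceq> R[i := R ! i + 1]" using less inv unfolding seq_less_def by (blast intro: seq_le_trans)
  then show "weak_invariant R0 (weak_step m n \<Sigma> R) M"
    unfolding weak_invariant_def step using len sorted gaps rows minimal by simp
qed

text \<open>If the first rank exceeded \<open>M + n\<close>, no arrow would meet the rows up to
  \<open>M\<close>. Then no row would be negative, so all counts would vanish and the loop would
  have stopped. The gap bound carries the bound on the first rank over to all the others.\<close>

lemma weak_invariant_bounded:
  assumes inv: "weak_invariant R0 R M" and "\<not> stop_condition m n \<Sigma> R"
  shows "R \<preceq> replicate (length \<Sigma>) (M + int n + int (length \<Sigma>) * int (m + n + 1))"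
proof -
  note inv = inv [unfolded weak_invariant_def]
  have 0: "R ! 0 \<le> M + int n"
  proof (rule ccontr)
    assume large: "\<not> ?thesis"
    have "row_count m n \<Sigma> R j \<ge> 0" for j
    proof (cases "j > M")
      case False
      have "j < R ! i - int n" if "i < length \<Sigma>" for i
        using large False that inv sorted_nth_mono [of R 0 i] by auto
      then show ?thesis by (simp add: row_count_eq_0_below)
    qed (use inv in blast)
    then have "row_count m n \<Sigma> R j = 0" for j
      using row_counts_zero inv by blast
    then show False using assms(2) by (simp add: stop_condition_def)
  qed
  have gaps: "R ! i \<le> M + int n + int i * int (m + n + 1)" if "i < length \<Sigma>" for i
    using that
  proof (induction i)
    case (Suc i)
    have "R ! Suc i \<le> R ! i + int (m + n + 1)" using inv Suc.prems by blast
    then show ?case using Suc by (simp add: algebra_simps)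
  qed (use 0 in simp)
  have "R ! i \<le> M + int n + int (length \<Sigma>) * int (m + n + 1)" if "i < length \<Sigma>" for i
  proof -
    have "int i * int (m + n + 1) \<le> int (length \<Sigma>) * int (m + n + 1)"
      using that by (intro mult_right_mono) auto
    with gaps [OF that] show ?thesis by linarith
  qed
  moreover have "length R = length \<Sigma>" using inv by blast
  ultimately show ?thesis by (simp add: seq_le_iff)
qed

lemma weak_find_rank:
  assumes "weak_invariant R0 R0 M"
  shows "weak_invariant R0 (weak_find_rank m n \<Sigma> R0) M"
    and "stop_condition m n \<Sigma> (weak_find_rank m n \<Sigma> R0)"
proof -
  \<comment> \<open>\<open>B\<close> bounds the rank sum as long as the loop runs, so
    \<open>B + 1 - sum_list R\<close> is a positive measure that decreases with each step.\<close>
  define B where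
    "B = sum_list (replicate (length \<Sigma>) (M + int n + int (length \<Sigma>) * int (m + n + 1)))"
  have "weak_invariant R0 (weak_find_rank m n \<Sigma> R0) M \<and>
      stop_condition m n \<Sigma> (weak_find_rank m n \<Sigma> R0)"
    unfolding weak_find_rank_def
  proof (rule while_rule [where P = "\<lambda>R. weak_invariant R0 R M"
        and r = "measure (\<lambda>R. nat (B + 1 - sum_list R))"])
    fix R assume R: "weak_invariant R0 R M" "\<not> stop_condition m n \<Sigma> R"
    then show "weak_invariant R0 (weak_step m n \<Sigma> R) M" by (rule weak_invariant_step)
    have "sum_list R \<le> B"
      using sum_list_mono_seq_le [OF weak_invariant_bounded [OF R]] by (simp add: B_def)
    moreover have "sum_list R < sum_list (weak_step m n \<Sigma> R)"
      using weak_invariant_step(2) [OF R] by (rule sum_list_strict_mono_seq_less)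
    ultimately show "(weak_step m n \<Sigma> R, R) \<in> measure (\<lambda>R. nat (B + 1 - sum_list R))"
      by simp
  qed (use assms in auto)
  then show "weak_invariant R0 (weak_find_rank m n \<Sigma> R0) M"
    "stop_condition m n \<Sigma> (weak_find_rank m n \<Sigma> R0)" by auto
qed

section \<open>The starting sequence\<close>

lemma length_starting_seq: "length (starting_seq k \<Sigma>) = length \<Sigma>"
  unfolding starting_seq_def by (metis length_append length_map takeWhile_dropWhile_id)

lemma starting_seq_nth:
  assumes "i < length \<Sigma>"
  shows "starting_seq k \<Sigma> ! i = (if i < length (takeWhile (\<lambda>a. a = S) \<Sigma>) then 0 else int k)"
proof -
  have "length \<Sigma> = length (takeWhile (\<lambda>a. a = S) \<Sigma>) + length (dropWhile (\<lambda>a. a = S) \<Sigma>)"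
    by (metis length_append takeWhile_dropWhile_id)
  then show ?thesis using assms by (simp add: starting_seq_def nth_append)
qed

text \<open>All ranks lie between 0 and \<open>k\<close>: the rows above \<open>k + m\<close> are
  empty, and the assumption on \<open>k\<close> bounds the only possible jump.\<close>

lemma weak_invariant_starting_seq:
  assumes "k \<le> m + n"
  shows "weak_invariant (starting_seq k \<Sigma>) (starting_seq k \<Sigma>) (int (k + m))"
proof -
  have bounds: "0 \<le> starting_seq k \<Sigma> ! i \<and> starting_seq k \<Sigma> ! i \<le> int k" if "i < length \<Sigma>" for i
    using that by (simp add: starting_seq_nth)
  have "row_count m n \<Sigma> (starting_seq k \<Sigma>) j = 0" if "j > int (k + m)" for j
    using that bounds by (intro row_count_eq_0_above) fastforce
  moreover have "sorted (starting_seq k \<Sigma>)"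
    unfolding starting_seq_def by (auto simp: sorted_append sorted_map)
  moreover have "starting_seq k \<Sigma> ! Suc i \<le> starting_seq k \<Sigma> ! i + int (m + n + 1)"
    if "Suc i < length \<Sigma>" for i
    using that bounds [of i] bounds [of "Suc i"] assms by simp
  ultimately show ?thesis
    by (simp add: weak_invariant_def length_starting_seq seq_le_refl)
qed

text \<open>A blue arrow ends at a starting level, and none of these lies below
  \<open>X ! 0\<close>.\<close>

lemma stop_condition_W_ge:
  assumes "length X = length \<Sigma>" "sorted X" "stop_condition m n \<Sigma> X"
    and "i < length \<Sigma>" "\<Sigma> ! i = W"
  shows "X ! i \<ge> X ! 0 + int n"
proof -
  have "X ! i - int n \<in> set X"
    using arrow_end_in_set [of X i] assms by (simp add: arrow_end_def)
  then obtain a where "a < length X" "X ! a = X ! i - int n" by (auto simp: in_set_conv_nth)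
  then show ?thesis using sorted_nth_mono [OF assms(2), of 0 a] by simp
qed

text \<open>The first \<open>W\<close> has rank at least \<open>n\<close>, hence by sortedness so
  does every later letter; \<open>k \<le> n\<close> places the starting level below them.\<close>

lemma starting_seq_le:
  assumes X: "length X = length \<Sigma>" "sorted X" "stop_condition m n \<Sigma> X" "X ! 0 = 0" and "k \<le> n"
  shows "starting_seq k \<Sigma> \<preceq> X"
proof -
  let ?p = "length (takeWhile (\<lambda>a. a = S) \<Sigma>)"
  have "starting_seq k \<Sigma> ! i \<le> X ! i" if i: "i < length \<Sigma>" for i
  proof (cases "i < ?p")
    case True
    then show ?thesis using i X sorted_nth_mono [OF X(2), of 0 i] by (simp add: starting_seq_nth)
  next
    case False
    then have p: "?p < length \<Sigma>" using i by simp
    then have "\<Sigma> ! ?p \<noteq> S" using nth_length_takeWhile by blast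
    then have "\<Sigma> ! ?p = W" by (cases "\<Sigma> ! ?p") auto
    then have "int n \<le> X ! ?p" using stop_condition_W_ge [OF X(1-3) p] X(4) by simp
    also have "\<dots> \<le> X ! i" using False i X sorted_nth_mono [OF X(2), of ?p i] by simp
    finally show ?thesis using False i assms by (simp add: starting_seq_nth)
  qed
  then show ?thesis by (simp add: seq_le_iff length_starting_seq X(1))
qed

section \<open>StrongFindRank and the canonical rank sequence\<close>

text \<open>The increment stays below \<open>X\<close> as in WeakFindRank. Since \<open>X\<close> is
  strictly increasing, the strict cover then stays below it by minimality.\<close>

lemma strong_step_bounded:
  assumes "\<not> stop_condition m n \<Sigma> R" "length R = length \<Sigma>" "sorted_wrt (<) R"
    and X: "R \<preceq> X" "sorted_wrt (<) X" "stop_condition m n \<Sigma> X"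
  shows "strong_step m n \<Sigma> R \<preceq> X"
proof -
  obtain i where i: "i < length \<Sigma>" "R ! i = lowest_positive_row m n \<Sigma> R"
      "\<And>a. i < a \<Longrightarrow> a < length \<Sigma> \<Longrightarrow> R ! i < R ! a"
    and step: "strong_step m n \<Sigma> R = strict_cover (R[i := R ! i + 1])"
    using assms(1-3) by (rule strong_step_eq) blast
  have "R[i := R ! i + 1] \<preceq> X"
    using assms i lowest_positive_row(1) [OF assms(1)]
    by (intro seq_le_increment [of R X \<Sigma> m n]) (auto simp: strict_sorted_imp_sorted)
  then show ?thesis unfolding step using X(2) by (rule strict_cover_le)
qed

lemma strong_step_increases:
  assumes "\<not> stop_condition m n \<Sigma> R" "length R = length \<Sigma>" "sorted_wrt (<) R"
  shows "R \<prec> strong_step m n \<Sigma> R" "sorted_wrt (<) (strong_step m n \<Sigma> R)"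
proof -
  obtain i where i: "i < length \<Sigma>"
    and step: "strong_step m n \<Sigma> R = strict_cover (R[i := R ! i + 1])"
    using assms by (rule strong_step_eq) blast
  have "R \<prec> R[i := R ! i + 1]" using i assms(2) by (intro seq_less_increment) simp
  then show "R \<prec> strong_step m n \<Sigma> R"
    unfolding step using seq_le_strict_cover by (rule seq_less_le_trans)
  show "sorted_wrt (<) (strong_step m n \<Sigma> R)"
    unfolding step by (rule strict_sorted_strict_cover)
qed

lemma strong_find_rank:
  assumes k: "k \<le> n"
  defines "Rt \<equiv> canonical_rank_seq k m n \<Sigma>"
  shows "\<And>s. strong_reaches k m n \<Sigma> s \<Longrightarrow> strong_rank_seq k m n \<Sigma> s \<preceq> Rt"
    and "\<And>s. strong_reaches k m n \<Sigma> (Suc s) \<Longrightarrow>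
          strong_rank_seq k m n \<Sigma> s \<prec> strong_rank_seq k m n \<Sigma> (Suc s)"
    and "\<exists>s. strong_rank_seq k m n \<Sigma> s = Rt \<and> strong_outputs k m n \<Sigma> s Rt"
proof -
  let ?Z = "starting_seq k \<Sigma>"
  let ?R = "strong_rank_seq k m n \<Sigma>"
  define Rb where "Rb = weak_find_rank m n \<Sigma> ?Z"
  have inv: "weak_invariant ?Z Rb (int (k + m))" and stop: "stop_condition m n \<Sigma> Rb"
    using weak_find_rank [OF weak_invariant_starting_seq] k by (auto simp: Rb_def)
  then have lenb: "length Rb = length \<Sigma>" and "sorted Rb" and R0_Rb: "?Z \<preceq> Rb"
    and minimal: "\<And>X. sorted X \<Longrightarrow> stop_condition m n \<Sigma> X \<Longrightarrow> ?Z \<preceq> X \<Longrightarrow> Rb \<preceq> X"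
    by (auto simp: weak_invariant_def)
  have len0: "0 < length \<Sigma>" using length_eq m_pos by simp
  then have hd: "hd Rb = Rb ! 0" using lenb by (intro hd_conv_nth) auto
  have Rt: "Rt = map (\<lambda>r. r - hd Rb) Rb"
    by (simp add: Rt_def Rb_def canonical_rank_seq_def Let_def)
  have lent: "length Rt = length \<Sigma>" by (simp add: Rt lenb)
  have "sorted_wrt (<) Rb"
    using distinct_of_stop [OF lenb stop] \<open>sorted Rb\<close> by (simp add: strict_sorted_iff)
  then have strictt: "sorted_wrt (<) Rt" unfolding Rt sorted_wrt_map by simp
  then have sortedt: "sorted Rt" by (rule strict_sorted_imp_sorted)
  have stopt: "stop_condition m n \<Sigma> Rt"
    using stop by (simp add: stop_condition_def Rt row_count_shift lenb)
  have "Rt ! 0 = 0" using len0 lenb by (simp add: Rt hd)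
  \<comment> \<open>Normalising can move \<open>Rb\<close> down, so the bound \<open>R0_Rb\<close>
    does not carry over by itself; it is rederived from the stopping condition and first rank
    0.\<close>
  then have R0_Rt: "?Z \<preceq> Rt" using lent sortedt stopt k by (intro starting_seq_le)
  have "0 \<le> Rb ! 0"
    using R0_Rb len0 by (auto simp: seq_le_iff length_starting_seq starting_seq_nth split: if_splits
        dest!: spec [of _ "0::nat"])
  then have Rt_Rb: "Rt \<preceq> Rb" by (simp add: seq_le_iff Rt hd)
  \<comment> \<open>The last conjunct says that each step adds at least 1 to the rank sum; together
    with the bound \<open>Rt\<close> it forces a stop.\<close>
  have reach: "length (?R s) = length \<Sigma> \<and> sorted_wrt (<) (?R s) \<and> ?Z \<preceq> ?R s \<and> ?R s \<preceq> Rt \<and>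
      sum_list (?R 0) + int s \<le> sum_list (?R s)"
    if "strong_reaches k m n \<Sigma> s" for s
    using that
  proof (induction s)
    case 0
    show ?case
      using strict_cover_le [OF R0_Rt strictt]
      by (simp add: strong_rank_seq_def length_starting_seq strict_sorted_strict_cover
          seq_le_strict_cover)
  next
    case (Suc s)
    then have IH: "length (?R s) = length \<Sigma>" "sorted_wrt (<) (?R s)" "?Z \<preceq> ?R s" "?R s \<preceq> Rt"
        "sum_list (?R 0) + int s \<le> sum_list (?R s)"
      and ns: "\<not> stop_condition m n \<Sigma> (?R s)"
      by (auto simp: strong_reaches_def)
    have step: "?R (Suc s) = strong_step m n \<Sigma> (?R s)" by (simp add: strong_rank_seq_def)
    have less: "?R s \<prec> ?R (Suc s)" and strict: "sorted_wrt (<) (?R (Suc s))"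
      unfolding step using strong_step_increases [OF ns IH(1,2)] by auto
    have "?R (Suc s) \<preceq> Rt"
      unfolding step using ns IH strictt stopt by (intro strong_step_bounded)
    moreover have "?Z \<preceq> ?R (Suc s)"
      using IH(3) less by (auto simp: seq_less_def intro: seq_le_trans)
    moreover have "length (?R (Suc s)) = length \<Sigma>"
      using less IH(1) by (simp add: seq_less_def seq_le_iff)
    moreover have "sum_list (?R s) < sum_list (?R (Suc s))"
      using less by (rule sum_list_strict_mono_seq_less)
    ultimately show ?case using strict IH(5) by simp
  qed
  then show "strong_reaches k m n \<Sigma> s \<Longrightarrow> ?R s \<preceq> Rt" for s by blast
  show "?R s \<prec> ?R (Suc s)" if "strong_reaches k m n \<Sigma> (Suc s)" for s
  proof -
    from that have "strong_reaches k m n \<Sigma> s" "\<not> stop_condition m n \<Sigma> (?R s)"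
      by (auto simp: strong_reaches_def)
    then show ?thesis
      using strong_step_increases(1) [of "?R s"] reach [of s] by (simp add: strong_rank_seq_def)
  qed
  have "\<exists>s. stop_condition m n \<Sigma> (?R s)"
  proof (rule ccontr)
    assume "\<not> ?thesis"
    then have "strong_reaches k m n \<Sigma> s" for s by (simp add: strong_reaches_def)
    then have "sum_list (?R 0) + int s \<le> sum_list Rt" for s
      using reach [of s] sum_list_mono_seq_le [of "?R s" Rt] by fastforce
    \<comment> \<open>After this many steps the rank sum would exceed that of
      \<open>Rt\<close>.\<close>
    from this [of "nat (sum_list Rt - sum_list (?R 0) + 1)"] show False
      by (simp split: if_splits)
  qed
  then obtain s where s: "stop_condition m n \<Sigma> (?R s)" "strong_reaches k m n \<Sigma> s"
    unfolding strong_reaches_def using exists_least_iff [of "\<lambda>s. stop_condition m n \<Sigma> (?R s)"] by blast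
  \<comment> \<open>The stopped sequence is itself a sorted stopping sequence above the start, so
    minimality of \<open>Rb\<close> applies. This yields
    \<open>Rt \<preceq> Rb \<preceq> ?R s \<preceq> Rt\<close>.\<close>
  have "Rb \<preceq> ?R s" using reach [OF s(2)] s(1) by (intro minimal) (auto simp: strict_sorted_imp_sorted)
  then have "Rt \<preceq> ?R s" using Rt_Rb by (rule seq_le_trans [rotated])
  then have "?R s = Rt" using reach [OF s(2)] by (intro seq_le_antisym) auto
  then show "\<exists>s. ?R s = Rt \<and> strong_outputs k m n \<Sigma> s Rt"
    using s by (auto simp: strong_outputs_def)
qed

end

section \<open>From Dyck paths to their words\<close>

lemma count_list_sw_word:
  "count_list (sw_word D) S = count_list D North" "count_list (sw_word D) W = count_list D East"
  unfolding sw_word_def by (induction D) (auto split: path_step.splits)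

lemma dyck_word_sw_word:
  assumes "m > 0" "n > 0" "coprime m n" "D \<in> dyck_paths m n"
  shows "dyck_word m n (sw_word D)"
proof
  have total: "path_point D (length D) = (m, n)" using assms(4) by (simp add: dyck_paths_def)
  then show "count_list (sw_word D) S = n" "count_list (sw_word D) W = m"
    by (simp_all add: path_point_def count_list_sw_word)
  have above: "n * count_list (take p D) East \<le> m * count_list (take p D) North"
    if "p \<le> length D" for p
  proof -
    have "real n * real (count_list (take p D) East) / real m \<le> real (count_list (take p D) North)"
      using assms(4) that by (auto simp: dyck_paths_def path_point_def)
    then have "real (n * count_list (take p D) East) \<le> real (m * count_list (take p D) North)"
      using assms(1) by (simp add: field_simps)
    then show ?thesis by (simp only: of_nat_le_iff)
  qed
  have "take p (sw_word D) = sw_word (take p D)" for p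
    by (simp add: sw_word_def take_map)
  \<comment> \<open>For \<open>p\<close> beyond the length the prefix is the whole word, which is
    the case \<open>p = length D\<close>.\<close>
  then show "n * count_list (take p (sw_word D)) W \<le> m * count_list (take p (sw_word D)) S" for p
    using above [of p] above [of "length D"] by (cases "p \<le> length D") (auto simp: count_list_sw_word)
qed (use assms in auto)

theorem theorem5:
  fixes k m n :: nat and D :: "path_step list" and \<Sigma> :: "letter list" and Rt :: "int list"
  assumes "m > 0" and "n > 0" and "coprime m n"
    and "D \<in> dyck_paths m n"
    and "k = n \<or> (k = m \<and> m \<le> n)"
    and "\<Sigma> = sw_word D"
    and "Rt = canonical_rank_seq k m n \<Sigma>"
  shows "(\<forall>s. strong_reaches k m n \<Sigma> s \<longrightarrow> strong_rank_seq k m n \<Sigma> s \<preceq> Rt)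
    \<and> (\<forall>s. strong_reaches k m n \<Sigma> (Suc s) \<longrightarrow>
          strong_rank_seq k m n \<Sigma> s \<prec> strong_rank_seq k m n \<Sigma> (Suc s))
    \<and> (\<exists>s. strong_rank_seq k m n \<Sigma> s = Rt \<and> strong_outputs k m n \<Sigma> s Rt)"
proof -
  interpret dyck_word m n \<Sigma> using assms(1-4) unfolding assms(6) by (rule dyck_word_sw_word)
  have "k \<le> n" using assms(5) by auto
  then show ?thesis unfolding assms(7) using strong_find_rank by blast
qed

end
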